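(* Let $\lambda\ge\omega_2$ be a cardinal and assume $\mu^{\omega}=\mu^+$ for each cardinal $\mu<\lambda$ with $\operatorname{cf}(\mu)=\omega$. Then $[\lambda,\kappa,\omega]\Rightarrow\omega_2$ holds for every cardinal $\kappa$ with $\omega_2\le\kappa\le\lambda$.
   Context: For a function $f$ and set $A$, $I_f(A)=\{\xi\in\operatorname{ran}(f):|A\cap f^{-1}\{\xi\}|=1\}$. A $(\lambda,\kappa,\mu)$-system is a family $\mathcal A$ with $|\mathcal A|=\lambda$, $|A|=\kappa$ for all $A\in\mathcal A$, and $|A\cap A'|<\mu$ for distinct $A,A'\in\mathcal A$. For cardinals $\lambda\ge\kappa\ge\rho\ge\omega$ and $\mu\le\kappa$, $[\lambda,\kappa,\mu]\Rightarrow\rho$ means: for every $(\lambda,\kappa,\mu)$-system $\mathcal A$ there is a function $f:\bigcup\mathcal A\to\rho$ such that $|\rho\setminus I_f(A)|<\rho$ for all $A\in\mathcal A$. *)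

theory Defs
  imports Main
begin

unbundle cardinal_syntax

text \<open>Cardinals are represented by cardinal well-orders (BNF_Cardinal_Order_Relation):
  card_of A is the cardinal of A, natLeq is omega, cardSuc is the successor cardinal,
  cexp is cardinal exponentiation.\<close>

definition omega2 :: "nat set set rel" where
  "omega2 = cardSuc (cardSuc natLeq)"

definition cofinal_in :: "'a rel \<Rightarrow> 'a set \<Rightarrow> bool" where
  "cofinal_in r S \<longleftrightarrow> S \<subseteq> Field r \<and> (\<forall>a\<in>Field r. \<exists>b\<in>S. (a, b) \<in> r)"

definition cf_is_omega :: "'a rel \<Rightarrow> bool" where
  "cf_is_omega r \<longleftrightarrow>
     (\<exists>S. cofinal_in r S \<and> card_of S =o natLeq) \<and>
     (\<forall>S. cofinal_in r S \<longrightarrow> natLeq \<le>o card_of S)"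

definition I_f :: "('a \<Rightarrow> 'b) \<Rightarrow> 'a set \<Rightarrow> 'b set" where
  "I_f f A = {\<xi> \<in> f ` A. card (A \<inter> f -` {\<xi>}) = 1}"

definition is_system :: "'a set set \<Rightarrow> 'l rel \<Rightarrow> 'k rel \<Rightarrow> 'm rel \<Rightarrow> bool" where
  "is_system \<A> l k m \<longleftrightarrow>
     card_of \<A> =o l \<and>
     (\<forall>A\<in>\<A>. card_of A =o k) \<and>
     (\<forall>A\<in>\<A>. \<forall>A'\<in>\<A>. A \<noteq> A' \<longrightarrow> card_of (A \<inter> A') <o m)"

end

theory Submission
  imports Defs
begin

text \<open>Say that \<open>A\<close> is traced by a set \<open>S\<close> if \<open>A \<inter> S\<close> is uncountable. The arithmetical
  hypothesis implies that a set \<open>S\<close> with \<open>|S| \<le> \<lambda>\<close> traces at most \<open>|S|\<close> members of the system: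
  by almost disjointness a member is determined by any infinite part of it, and an uncountable trace
  already has an infinite part in a proper initial segment of \<open>S\<close>. Only this counting property is
  used from then on, and the colouring is built by induction on the size of the ground set \<open>X\<close>.
  If \<open>|X| \<le> \<kappa>\<close>, a transfinite recursion chooses a point \<open>x(A, \<xi>)\<close> of \<open>A\<close> for every member \<open>A\<close> and
  every \<open>\<xi> < \<omega>\<^sub>2\<close>, outside all other members traced by the points chosen before; then a member \<open>A\<close>
  contains at most \<open>\<omega>\<^sub>1\<close> points chosen for other members, and \<open>x(A, \<xi>)\<close> gets colour \<open>\<xi>\<close>.
  If \<open>|X| > \<kappa>\<close>, then \<open>X\<close> is the union of an increasing chain of smaller sets, each containing every
  member that it traces. A member meets the union of those sets of the chain that do not trace it in
  at most \<open>\<omega>\<^sub>1\<close> points, so the colourings of the successive differences can be glued.\<close>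

section \<open>Elementary facts on cardinals\<close>

abbreviation omega1 :: "nat set rel" where
  "omega1 \<equiv> cardSuc natLeq"

lemma Card_order_omega1: "Card_order omega1"
  by (simp add: cardSuc_Card_order natLeq_Card_order)

lemma Card_order_omega2: "Card_order omega2"
  by (simp add: omega2_def cardSuc_Card_order Card_order_omega1)

lemma infinite_omega1: "infinite (Field omega1)"
  using cardSuc_finite[OF natLeq_Card_order] by (simp add: Field_natLeq)

lemma infinite_omega2: "infinite (Field omega2)"
  unfolding omega2_def using cardSuc_finite[OF Card_order_omega1] infinite_omega1 by blast

lemma ordLess_omega1: "|A| <o omega1 \<longleftrightarrow> |A| \<le>o natLeq"
  by (rule cardSuc_ordLeq_ordLess[OF natLeq_Card_order card_of_Card_order])

lemma ordLess_omega2: "|A| <o omega2 \<longleftrightarrow> |A| \<le>o omega1"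
  unfolding omega2_def by (rule cardSuc_ordLeq_ordLess[OF Card_order_omega1 card_of_Card_order])

lemma card_of_subset_ordLeq: "A \<subseteq> B \<Longrightarrow> |B| \<le>o r \<Longrightarrow> |A| \<le>o r"
  by (rule ordLeq_transitive[OF card_of_mono1])

lemma card_of_subset_ordLess: "A \<subseteq> B \<Longrightarrow> |B| <o r \<Longrightarrow> |A| <o r"
  by (rule ordLeq_ordLess_trans[OF card_of_mono1])

lemma not_card_of_ordLeq: "Card_order r \<Longrightarrow> \<not> |A| \<le>o r \<longleftrightarrow> r <o |A|"
  using not_ordLeq_iff_ordLess card_of_Well_order card_order_on_def by blast

lemma not_card_of_ordLess: "Card_order r \<Longrightarrow> \<not> |A| <o r \<longleftrightarrow> r \<le>o |A|"
  using not_ordLess_iff_ordLeq card_of_Well_order card_order_on_def by blast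

lemma infinite_Card_order_mono:
  assumes "Card_order r" "Card_order c" "infinite (Field r)" "r \<le>o c"
  shows "infinite (Field c)"
  using assms by (meson card_of_mono2 card_of_ordLeq_infinite)

lemma finite_imp_ordLess:
  assumes "Card_order r" "infinite (Field r)" "finite A"
  shows "|A| <o r"
  by (metis assms card_of_ordLeq_finite card_of_mono2 Field_card_of not_card_of_ordLess)

lemma card_of_underS_card_of: "a \<in> M \<Longrightarrow> |underS ( |M| ) a| <o |M|"
  by (rule card_of_underS[OF card_of_Card_order]) (simp add: Field_card_of)

section \<open>Counting along a well-order\<close>

lemma Well_order_least:
  assumes r: "Well_order r" and i: "i \<in> Field r" "P i"
  shows "\<exists>p\<in>Field r. P p \<and> (\<forall>j\<in>underS r p. \<not> P j)"
proof -
  have wf: "wf (r - Id)" using r well_order_on_def by blast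
  have "i \<in> {i \<in> Field r. P i}" using i by blast
  then show ?thesis
  proof (rule wfE_min[OF wf])
    fix p assume p: "p \<in> {i \<in> Field r. P i}"
      "\<And>j. (j, p) \<in> r - Id \<Longrightarrow> j \<notin> {i \<in> Field r. P i}"
    have "\<not> P j" if "j \<in> underS r p" for j
      using p(2)[of j] that by (auto simp: underS_def Field_def)
    then show ?thesis using p(1) by blast
  qed
qed

lemma underS_if_not_le:
  assumes r: "Well_order r" and "a \<in> Field r" "b \<in> Field r" "(a, b) \<notin> r"
  shows "b \<in> underS r a"
proof -
  have "(b, a) \<in> r" "(a, a) \<in> r"
    using wo_rel.TOTALS[of r] assms unfolding wo_rel_def by auto
  then show ?thesis using assms(4) by (auto simp: underS_def)
qed

text \<open>If \<open>Q\<close> were larger than \<open>c\<close>, the order induced on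
  \<open>Q\<close> would be longer than \<open>c\<close>, and \<open>c\<close> would be isomorphic
  to a proper initial segment of it, which is too small. Used with \<open>c = natLeq\<close> for
  finite segments and with \<open>c = omega1\<close> for countable ones.\<close>

lemma card_of_ordLeq_if_small_initial_segments:
  assumes r: "Well_order r" and c: "Card_order c" and Q: "Q \<subseteq> Field r"
    and small: "\<And>p. p \<in> Q \<Longrightarrow> |Q \<inter> underS r p| <o c"
  shows "|Q| \<le>o c"
proof (rule ccontr)
  assume "\<not> |Q| \<le>o c"
  then have "c <o |Q|" using not_card_of_ordLeq[OF c] by blast
  let ?r = "Restr r Q"
  have wo: "well_order_on Q ?r" using r Q by (rule well_order_on_Restr)
  have F: "Field ?r = Q" using wo well_order_on_Field by force
  have W: "Well_order ?r" using wo F by simp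
  have "|Q| \<le>o ?r" using wo by (rule card_of_least)
  with \<open>c <o |Q|\<close> have "c <o ?r" by (rule ordLess_ordLeq_trans)
  moreover have "Well_order c" using c card_order_on_def by blast
  ultimately obtain a where a: "a \<in> Q" "c =o Restr ?r (underS ?r a)"
    using ordLess_iff_ordIso_Restr[OF W] F by blast
  have "|Field c| =o |Field (Restr ?r (underS ?r a))|" using a(2) by (rule card_of_cong)
  moreover have "Field (Restr ?r (underS ?r a)) \<subseteq> Q \<inter> underS r a"
    by (auto simp: Field_def underS_def)
  ultimately have "|Field c| \<le>o |Q \<inter> underS r a|"
    using card_of_mono1 ordIso_ordLeq_trans by blast
  then have "c \<le>o |Q \<inter> underS r a|"
    using c card_of_Field_ordIso ordIso_ordLeq_trans ordIso_symmetric by blast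
  then show False using small[OF a(1)] not_ordLess_ordLeq by blast
qed

text \<open>Only the indices in \<open>Q\<close>, where some new element appears, matter for the
  union. Choosing a new element at each of them gives an injection that sends the part of
  \<open>Q\<close> below \<open>p\<close> into the countable set \<open>Y p\<close>, so
  \<open>Q\<close> has at most \<open>omega1\<close> elements. The length of the chain is
  arbitrary.\<close>

lemma chain_union_card:
  fixes Y :: "'i \<Rightarrow> 'b set"
  assumes r: "Well_order r" and I: "I \<subseteq> Field r"
    and mono: "\<And>i j. (i, j) \<in> r \<Longrightarrow> Y i \<subseteq> Y j"
    and small: "\<And>i. i \<in> I \<Longrightarrow> |Y i| \<le>o natLeq"
  shows "|\<Union>i\<in>I. Y i| \<le>o omega1"
proof -
  define Q where "Q = {p \<in> I. \<exists>y\<in>Y p. \<forall>j\<in>I \<inter> underS r p. y \<notin> Y j}"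
  have "\<forall>p. \<exists>y. p \<in> Q \<longrightarrow> y \<in> Y p \<and> (\<forall>j\<in>I \<inter> underS r p. y \<notin> Y j)"
    unfolding Q_def by blast
  then obtain g where g: "\<And>p. p \<in> Q \<Longrightarrow> g p \<in> Y p"
      "\<And>p j. p \<in> Q \<Longrightarrow> j \<in> I \<Longrightarrow> j \<in> underS r p \<Longrightarrow> g p \<notin> Y j"
    by (metis IntI)
  have QI: "Q \<subseteq> I" by (auto simp: Q_def)
  have tot: "p \<in> underS r q \<or> q \<in> underS r p" if "p \<in> Q" "q \<in> Q" "p \<noteq> q" for p q
    using r QI I that unfolding well_order_on_def linear_order_on_def total_on_def underS_def
    by blast
  have inj: "inj_on g Q"
  proof (rule inj_onI, rule ccontr)
    fix p q assume pq: "p \<in> Q" "q \<in> Q" "g p = g q" "p \<noteq> q"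
    from tot[OF pq(1,2,4)] show False
      using g(1)[OF pq(1)] g(1)[OF pq(2)] g(2)[OF pq(1), of q] g(2)[OF pq(2), of p] pq QI
      by auto
  qed
  have seg: "|Q \<inter> underS r p| <o omega1" if p: "p \<in> Q" for p
  proof -
    have "g ` (Q \<inter> underS r p) \<subseteq> Y p"
      using g(1) mono by (fastforce simp: underS_def)
    moreover have "inj_on g (Q \<inter> underS r p)" using inj by (rule inj_on_subset) blast
    ultimately have "|Q \<inter> underS r p| \<le>o |Y p|" using card_of_ordLeq by blast
    then show ?thesis using small p QI ordLess_omega1 ordLeq_transitive by blast
  qed
  have "|Q| \<le>o omega1"
    by (rule card_of_ordLeq_if_small_initial_segments[OF r Card_order_omega1 _ seg])
      (use QI I in auto)
  moreover have "|Y i| \<le>o omega1" if "i \<in> Q" for i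
    using that small QI cardSuc_ordLeq[OF natLeq_Card_order] ordLeq_transitive by blast
  ultimately have "|\<Union>i\<in>Q. Y i| \<le>o omega1"
    using card_of_UNION_ordLeq_infinite_Field[OF infinite_omega1 Card_order_omega1] by blast
  moreover have "(\<Union>i\<in>I. Y i) \<subseteq> (\<Union>i\<in>Q. Y i)"
  proof
    fix y assume "y \<in> (\<Union>i\<in>I. Y i)"
    then have "\<exists>i\<in>Field r. i \<in> I \<and> y \<in> Y i" using I by blast
    then obtain p where "p \<in> I" "y \<in> Y p" "\<forall>j\<in>underS r p. \<not> (j \<in> I \<and> y \<in> Y j)"
      using Well_order_least[OF r, where P = "\<lambda>i. i \<in> I \<and> y \<in> Y i"] by blast
    then have "p \<in> Q" "y \<in> Y p" by (auto simp: Q_def)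
    then show "y \<in> (\<Union>i\<in>Q. Y i)" by blast
  qed
  ultimately show ?thesis by (metis card_of_subset_ordLeq)
qed

section \<open>How many members are traced by a set\<close>

lemma finite_bounded:
  assumes r: "Well_order r" and "finite F" "F \<subseteq> Field r" "F \<noteq> {}"
  shows "\<exists>b\<in>Field r. \<forall>a\<in>F. (a, b) \<in> r"
  using assms(2,4,3)
proof (induction F rule: finite_ne_induct)
  case (singleton x)
  then show ?case using r unfolding order_on_defs refl_on_def by auto
next
  case (insert x F)
  then obtain b where b: "b \<in> Field r" "\<forall>a\<in>F. (a, b) \<in> r" by auto
  have x: "x \<in> Field r" using insert by auto
  have refl: "(x, x) \<in> r" using r x unfolding order_on_defs refl_on_def by auto
  have tr: "trans r" using r unfolding order_on_defs by auto
  consider "(x, b) \<in> r" | "(b, x) \<in> r"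
    using r b x refl unfolding order_on_defs total_on_def by (cases "x = b") auto
  then show ?case
  proof cases
    case 1 then show ?thesis using b by blast
  next
    case 2
    then have "\<forall>a\<in>insert x F. (a, x) \<in> r" using b refl transD[OF tr] by blast
    then show ?thesis using x by blast
  qed
qed

text \<open>A finite set has an upper bound and an infinite cardinal has no largest element, so no
  finite set is cofinal. Thus \<open>cf_is_omega\<close> can fail only because no countably infinite
  set is cofinal; in particular \<open>T\<close> is not.\<close>

lemma bounded_if_not_cf_omega:
  assumes M: "infinite M" and cf: "\<not> cf_is_omega |M|" and T: "T \<subseteq> M" "|T| =o natLeq"
  shows "\<exists>a\<in>M. T \<subseteq> underS ( |M| ) a"
proof -
  have W: "Well_order |M|" by (rule card_of_Well_order)
  have "natLeq \<le>o |S|" if S: "cofinal_in ( |M| ) S" for S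
  proof (rule ccontr)
    assume "\<not> natLeq \<le>o |S|"
    then have "finite S" using infinite_iff_natLeq_ordLeq by blast
    moreover have "S \<subseteq> Field |M|" "S \<noteq> {}"
      using S M by (auto simp: cofinal_in_def Field_card_of)
    ultimately have "\<exists>b\<in>Field |M|. \<forall>a\<in>S. (a, b) \<in> |M|"
      by (rule finite_bounded[OF W])
    then obtain b where b: "b \<in> Field |M|" "\<forall>a\<in>S. (a, b) \<in> |M|" by (rule bexE)
    obtain c where c: "c \<in> Field |M|" "b \<noteq> c" "(b, c) \<in> |M|"
      using infinite_Card_order_limit[OF card_of_Card_order, of M b] b(1) M
      by (auto simp: Field_card_of)
    obtain d where "d \<in> S" "(c, d) \<in> |M|" using S c by (auto simp: cofinal_in_def)
    moreover have "trans |M|" "antisym |M|" using W unfolding order_on_defs by auto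
    ultimately have "(c, b) \<in> |M|" using b(2) by (metis transD)
    then show False using c \<open>antisym |M|\<close> by (metis antisymD)
  qed
  then have "\<not> cofinal_in ( |M| ) T" using cf T unfolding cf_is_omega_def by blast
  then obtain a where a: "a \<in> M" "\<And>b. b \<in> T \<Longrightarrow> (a, b) \<notin> |M|"
    using T by (auto simp: cofinal_in_def Field_card_of)
  have "b \<in> underS ( |M| ) a" if "b \<in> T" for b
    using underS_if_not_le[OF W, of a b] a that T by (auto simp: Field_card_of)
  then show ?thesis using a by blast
qed

text \<open>A member is coded by an \<omega>-sequence in \<open>M\<close>. In cofinality \<omega>
  the hypothesis bounds the number of such sequences by the successor of \<open>|M|\<close>.
  Otherwise each sequence lies in a proper initial segment, and by induction each of the
  \<open>|M|\<close> segments accounts for at most \<open>|M|\<close> members. The map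
  \<open>g\<close> is there because the hypothesis concerns sets of type \<open>'l\<close>, not
  subsets of the ground set.\<close>

lemma card_infinite_trace:
  fixes l :: "'l rel" and g :: "'l \<Rightarrow> 'a" and \<A> :: "'a set set"
  assumes hyp: "\<And>M :: 'l set. |M| <o l \<Longrightarrow> cf_is_omega ( |M| ) \<Longrightarrow>
      BNF_Cardinal_Arithmetic.cexp ( |M| ) natLeq =o cardSuc ( |M| )"
    and ad: "\<And>A A'. A \<in> \<A> \<Longrightarrow> A' \<in> \<A> \<Longrightarrow> A \<noteq> A' \<Longrightarrow> finite (A \<inter> A')"
  shows "infinite M \<Longrightarrow> |M| <o l \<Longrightarrow> |{A \<in> \<A>. infinite (A \<inter> g ` M)}| \<le>o cardSuc |M|"
proof (induction M rule: wf_induct_rule[OF wf_inv_image[OF wf_ordLess, of card_of]])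
  case (1 M)
  define N where "N M = {A \<in> \<A>. infinite (A \<inter> g ` M)}" for M
  \<comment> \<open>An injective sequence in the trace is pulled back to \<open>M\<close>. Its image
    under \<open>g\<close> is an infinite subset of \<open>A\<close>, so by almost disjointness it
    determines \<open>A\<close>.\<close>
  have "\<exists>h :: nat \<Rightarrow> 'l. range h \<subseteq> M \<and> inj (g \<circ> h) \<and> range (g \<circ> h) \<subseteq> A" if A: "A \<in> N M" for A
  proof -
    obtain e :: "nat \<Rightarrow> 'a" where e: "inj e" "range e \<subseteq> A \<inter> g ` M"
      using A infinite_countable_subset unfolding N_def by blast
    have ge: "g (inv_into M g (e n)) = e n" "inv_into M g (e n) \<in> M" for n
      using e(2) by (auto intro!: f_inv_into_f inv_into_into)
    then have "g \<circ> (inv_into M g \<circ> e) = e" by auto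
    then show ?thesis
      using e ge by (intro exI[of _ "inv_into M g \<circ> e"]) auto
  qed
  then obtain h :: "'a set \<Rightarrow> nat \<Rightarrow> 'l" where
    h: "\<And>A. A \<in> N M \<Longrightarrow> range (h A) \<subseteq> M \<and> inj (g \<circ> h A) \<and> range (g \<circ> h A) \<subseteq> A"
    by metis
  have hM: "h A n \<in> M" if "A \<in> N M" for A n
    using h[OF that] by auto
  have suc: "|M| \<le>o cardSuc |M|" by (simp add: cardSuc_ordLeq card_of_Card_order)
  show ?case
  proof (cases "cf_is_omega ( |M| )")
    case True
    have "inj_on h (N M)"
    proof (rule inj_onI, rule ccontr)
      fix A A' assume *: "A \<in> N M" "A' \<in> N M" "h A = h A'" "A \<noteq> A'"
      then have "range (g \<circ> h A) \<subseteq> A \<inter> A'" using h by (metis le_inf_iff)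
      moreover have "finite (A \<inter> A')" using * ad by (auto simp: N_def)
      ultimately have "finite (range (g \<circ> h A))" by (rule finite_subset)
      then show False using h[OF *(1)] finite_imageD infinite_UNIV_nat by blast
    qed
    moreover have "h ` N M \<subseteq> Func (Field natLeq) (Field |M| )"
      using hM by (auto simp: Func_def Field_card_of Field_natLeq)
    ultimately have "|N M| \<le>o BNF_Cardinal_Arithmetic.cexp ( |M| ) natLeq"
      unfolding cexp_def using card_of_ordLeq by blast
    then show ?thesis using hyp[OF 1(3) True] ordLeq_ordIso_trans unfolding N_def by blast
  next
    case False
    have small: "|underS ( |M| ) a| <o |M|" if "a \<in> M" for a
      using that by (rule card_of_underS_card_of)
    have "N M \<subseteq> (\<Union>a\<in>M. N (underS ( |M| ) a))"
    proof
      fix A assume A: "A \<in> N M"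
      have inf: "infinite (range (g \<circ> h A))"
        using h[OF A] finite_imageD infinite_UNIV_nat by blast
      have "inj (h A)" using h[OF A] inj_on_imageI2 by blast
      then have "|UNIV :: nat set| =o |range (h A)|"
        using card_of_ordIsoI inj_on_imp_bij_betw by blast
      then have "|range (h A)| =o natLeq"
        using card_of_nat ordIso_symmetric ordIso_transitive by blast
      then obtain a where a: "a \<in> M" "range (h A) \<subseteq> underS ( |M| ) a"
        using bounded_if_not_cf_omega[OF 1(2) False] h[OF A] by meson
      have "range (g \<circ> h A) \<subseteq> A \<inter> g ` underS ( |M| ) a"
        using a(2) h[OF A] by auto
      then have "A \<in> N (underS ( |M| ) a)"
        using inf A finite_subset unfolding N_def by blast
      then show "A \<in> (\<Union>a\<in>M. N (underS ( |M| ) a))" using a by blast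
    qed
    moreover have "|N (underS ( |M| ) a)| \<le>o |M|" if a: "a \<in> M" for a
    proof (cases "finite (underS ( |M| ) a)")
      case True
      then have "N (underS ( |M| ) a) = {}" by (simp add: N_def)
      then show ?thesis by (simp add: card_of_empty)
    next
      case inf: False
      have "|underS ( |M| ) a| <o l" using small[OF a] 1(3) ordLess_transitive by blast
      with inf have "|N (underS ( |M| ) a)| \<le>o cardSuc |underS ( |M| ) a|"
        unfolding N_def using 1(1) small[OF a] by simp
      moreover have "cardSuc |underS ( |M| ) a| \<le>o |M|"
        using small[OF a] by (intro cardSuc_least card_of_Card_order)
      ultimately show ?thesis by (rule ordLeq_transitive)
    qed
    then have "|\<Union>a\<in>M. N (underS ( |M| ) a)| \<le>o |M|"
      using 1(2) by (intro card_of_UNION_ordLeq_infinite ballI card_of_mono1) auto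
    ultimately have "|N M| \<le>o |M|" by (rule card_of_subset_ordLeq)
    then show ?thesis using suc ordLeq_transitive unfolding N_def by blast
  qed
qed

text \<open>Uncountability removes the successor from the previous bound: a set whose proper initial
  segments are all finite is countable, so an uncountable trace is infinite on some segment
  \<open>U a\<close>. Since \<open>U a\<close> is smaller than \<open>S\<close>, the successor of
  its cardinal is still at most \<open>|S|\<close>.\<close>

lemma card_uncountable_trace:
  fixes l :: "'l rel" and \<A> :: "'a set set"
  assumes l: "Card_order l"
    and hyp: "\<And>M :: 'l set. |M| <o l \<Longrightarrow> cf_is_omega ( |M| ) \<Longrightarrow>
      BNF_Cardinal_Arithmetic.cexp ( |M| ) natLeq =o cardSuc ( |M| )"
    and ad: "\<And>A A'. A \<in> \<A> \<Longrightarrow> A' \<in> \<A> \<Longrightarrow> A \<noteq> A' \<Longrightarrow> finite (A \<inter> A')"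
    and S: "|S| \<le>o l"
  shows "|{A \<in> \<A>. \<not> |A \<inter> S| \<le>o natLeq}| \<le>o |S|"
proof (cases "|S| \<le>o natLeq")
  case True
  have "|A \<inter> S| \<le>o natLeq" for A
    using True by (rule card_of_subset_ordLeq[rotated]) blast
  then show ?thesis by (simp add: card_of_empty)
next
  case False
  then have inf: "infinite S"
    using finite_iff_ordLess_natLeq ordLess_imp_ordLeq by metis
  define U where "U a = underS ( |S| ) a" for a
  have small: "|U a| <o |S|" if "a \<in> S" for a
    using that unfolding U_def by (rule card_of_underS_card_of)
  have "{A \<in> \<A>. \<not> |A \<inter> S| \<le>o natLeq} \<subseteq> (\<Union>a\<in>S. {A \<in> \<A>. infinite (A \<inter> U a)})"
  proof
    fix A assume A: "A \<in> {A \<in> \<A>. \<not> |A \<inter> S| \<le>o natLeq}"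
    have "\<exists>p\<in>A \<inter> S. \<not> |A \<inter> S \<inter> underS ( |S| ) p| <o natLeq"
    proof (rule ccontr)
      assume "\<not> (\<exists>p\<in>A \<inter> S. \<not> |A \<inter> S \<inter> underS ( |S| ) p| <o natLeq)"
      then have "|A \<inter> S| \<le>o natLeq"
        by (intro card_of_ordLeq_if_small_initial_segments[OF card_of_Well_order[of S] natLeq_Card_order])
          (auto simp: Field_card_of)
      then show False using A by blast
    qed
    then obtain p where p: "p \<in> S" "infinite (A \<inter> S \<inter> U p)"
      by (auto simp: finite_iff_ordLess_natLeq U_def)
    have "infinite (A \<inter> U p)"
      by (rule infinite_super[OF _ p(2)]) auto
    then show "A \<in> (\<Union>a\<in>S. {A \<in> \<A>. infinite (A \<inter> U a)})"
      using p(1) A by blast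
  qed
  moreover have "|{A \<in> \<A>. infinite (A \<inter> U a)}| \<le>o |S|" if a: "a \<in> S" for a
  proof (cases "finite (U a)")
    case True
    then show ?thesis by (simp add: card_of_empty)
  next
    case infU: False
    have Ul: "|U a| <o l" using small[OF a] S ordLess_ordLeq_trans by blast
    then have "|U a| \<le>o |Field l|"
      using l card_of_Field_ordIso ordIso_symmetric ordLess_imp_ordLeq ordLeq_ordIso_trans by blast
    \<comment> \<open>A copy of \<open>U a\<close> inside the type \<open>'l\<close>, where the
      hypothesis applies; the inverse of \<open>f\<close> serves as the map \<open>g\<close> of the
      preceding lemma.\<close>
    then obtain f :: "'a \<Rightarrow> 'l" where f: "inj_on f (U a)"
      unfolding card_of_ordLeq[symmetric] by auto
    have iso: "|f ` U a| =o |U a|"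
      using f card_of_ordIsoI inj_on_imp_bij_betw ordIso_symmetric by blast
    have im: "inv_into (U a) f ` f ` U a = U a" using f by simp
    have "infinite (f ` U a)" using f infU finite_imageD by blast
    moreover have "|f ` U a| <o l" using iso Ul ordIso_ordLess_trans by blast
    ultimately have "|{A \<in> \<A>. infinite (A \<inter> inv_into (U a) f ` f ` U a)}| \<le>o cardSuc |f ` U a|"
      using card_infinite_trace[OF hyp ad] by blast
    moreover have "cardSuc |f ` U a| \<le>o |S|"
      using iso small[OF a] ordIso_ordLess_trans by (intro cardSuc_least card_of_Card_order) blast
    ultimately show ?thesis unfolding im by (rule ordLeq_transitive)
  qed
  then have "|\<Union>a\<in>S. {A \<in> \<A>. infinite (A \<inter> U a)}| \<le>o |S|"
    using inf by (intro card_of_UNION_ordLeq_infinite ballI card_of_mono1) auto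
  ultimately show ?thesis by (rule card_of_subset_ordLeq)
qed

section \<open>Sparse systems and good colourings\<close>

abbreviation traces :: "'a set set \<Rightarrow> 'a set \<Rightarrow> 'a set set" where
  "traces \<A> S \<equiv> {A \<in> \<A>. \<not> |A \<inter> S| \<le>o natLeq}"

text \<open>The last clause is all that is kept of the arithmetical hypothesis. It does not mention
  \<lambda> and passes to truncated members on smaller ground sets, as the induction on
  \<open>X\<close> requires.\<close>

definition sparse_system :: "'k rel \<Rightarrow> 'a set set \<Rightarrow> 'a set \<Rightarrow> bool" where
  "sparse_system k \<A> X \<longleftrightarrow>
     (\<forall>A\<in>\<A>. A \<subseteq> X \<and> |A| =o k) \<and>
     (\<forall>A\<in>\<A>. \<forall>A'\<in>\<A>. A \<noteq> A' \<longrightarrow> finite (A \<inter> A')) \<and>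
     (\<forall>S\<subseteq>X. |traces \<A> S| \<le>o |S| )"

definition well_colored :: "('a \<Rightarrow> nat set set) \<Rightarrow> 'a set \<Rightarrow> bool" where
  "well_colored f A \<longleftrightarrow> |Field omega2 - I_f f A| \<le>o omega1"

text \<open>A colour taken exactly once on \<open>B\<close> and never on \<open>A - B\<close> is
  taken exactly once on \<open>A\<close>, so the extra points spoil at most \<open>omega1\<close>
  colours.\<close>

lemma well_colored_extend:
  assumes sub: "B \<subseteq> A" and small: "|A - B| \<le>o omega1" and wc: "well_colored f B"
    and eq: "\<And>x. x \<in> B \<Longrightarrow> g x = f x"
  shows "well_colored g A"
proof -
  have "\<xi> \<in> I_f g A" if \<xi>: "\<xi> \<in> I_f f B" "\<xi> \<notin> g ` (A - B)" for \<xi>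
  proof -
    have "A \<inter> g -` {\<xi>} = B \<inter> f -` {\<xi>}" using sub eq \<xi>(2) by auto
    moreover have "\<xi> \<in> g ` A" using \<xi>(1) sub eq unfolding I_f_def by force
    ultimately show ?thesis using \<xi>(1) by (simp add: I_f_def)
  qed
  then have "Field omega2 - I_f g A \<subseteq> (Field omega2 - I_f f B) \<union> g ` (A - B)" by blast
  moreover have "|g ` (A - B)| \<le>o omega1" using card_of_image small ordLeq_transitive by blast
  then have "|(Field omega2 - I_f f B) \<union> g ` (A - B)| \<le>o omega1"
    using wc card_of_Un_ordLeq_infinite_Field[OF infinite_omega1 _ _ Card_order_omega1]
    unfolding well_colored_def by blast
  ultimately show ?thesis
    unfolding well_colored_def by (rule card_of_subset_ordLeq)
qed

section \<open>Ground sets of size at most \<kappa>\<close>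

lemma finite_Union_ordLess:
  assumes k: "Card_order k" "infinite (Field k)" and I: "|I| <o k"
    and fin: "\<And>i. i \<in> I \<Longrightarrow> finite (F i)"
  shows "|\<Union>i\<in>I. F i| <o k"
proof (cases "finite I")
  case True
  then show ?thesis using fin finite_imp_ordLess[OF k] by blast
next
  case False
  \<comment> \<open>Finite sets are no larger than the infinite index set, so the union is bounded
    by \<open>|I|\<close>; regularity of \<open>k\<close> is never invoked.\<close>
  have "|F i| \<le>o |I|" if "i \<in> I" for i
    using finite_imp_ordLess[OF card_of_Card_order, of I "F i"] False fin[OF that]
      ordLess_imp_ordLeq by (auto simp: Field_card_of)
  then have "|\<Union>i\<in>I. F i| \<le>o |I|"
    by (intro card_of_UNION_ordLeq_infinite[OF False] card_of_mono1 ballI) auto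
  then show ?thesis using I by (rule ordLeq_ordLess_trans)
qed

lemma omega1_less:
  assumes "omega2 \<le>o k" "|A| =o k"
  shows "omega1 <o |A|"
proof -
  have "omega1 <o omega2" unfolding omega2_def by (rule cardSuc_greater[OF Card_order_omega1])
  then show ?thesis
    using assms ordLess_ordLeq_trans ordLeq_ordIso_trans ordIso_symmetric by metis
qed

lemma omega1_less_imp_uncountable:
  assumes "omega1 <o |A|"
  shows "\<not> |A| \<le>o natLeq"
  using assms ordLeq_transitive[OF _ cardSuc_ordLeq[OF natLeq_Card_order], of "|A|"]
    not_ordLess_ordLeq by blast

lemma ex_coloring_of_small_ground_set:
  fixes \<A> :: "'a set set"
  assumes k: "Card_order k" "omega2 \<le>o k" and sp: "sparse_system k \<A> X" and X: "|X| \<le>o k"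
  shows "\<exists>f. f ` X \<subseteq> Field omega2 \<and> (\<forall>A\<in>\<A>. well_colored f A)"
proof -
  have infk: "infinite (Field k)"
    using infinite_Card_order_mono[OF Card_order_omega2 k(1) infinite_omega2 k(2)] .
  have sub: "\<And>A. A \<in> \<A> \<Longrightarrow> A \<subseteq> X" and card: "\<And>A. A \<in> \<A> \<Longrightarrow> |A| =o k"
    and ad: "\<And>A A'. A \<in> \<A> \<Longrightarrow> A' \<in> \<A> \<Longrightarrow> A \<noteq> A' \<Longrightarrow> finite (A \<inter> A')"
    and tr: "\<And>S. S \<subseteq> X \<Longrightarrow> |traces \<A> S| \<le>o |S|"
    using sp unfolding sparse_system_def by auto
  have unc: "\<not> |A| \<le>o natLeq" if "A \<in> \<A>" for A
    using omega1_less[OF k(2) card[OF that]] by (rule omega1_less_imp_uncountable)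
  define P where "P = \<A> \<times> Field omega2"
  \<comment> \<open>Ordering \<open>P\<close> by its cardinal leaves fewer than \<open>k\<close>
    earlier pairs at each step of the recursion.\<close>
  define r where "r = |P|"
  have W: "Well_order r" and F: "Field r = P"
    unfolding r_def by (rule card_of_Well_order, rule Field_card_of)
  \<comment> \<open>Members are uncountable subsets of \<open>X\<close>, so sparseness applied to
    \<open>X\<close> itself bounds their number.\<close>
  have "traces \<A> X = \<A>"
    using sub unc by (auto simp: inf_absorb1)
  then have "|\<A>| \<le>o k" using tr[of X] X ordLeq_transitive by auto
  moreover have "|Field omega2| \<le>o k"
    using card_of_Field_ordIso[OF Card_order_omega2] k(2) by (rule ordIso_ordLeq_trans)
  ultimately have Pk: "|P| \<le>o k"
    unfolding P_def using card_of_Times_ordLeq_infinite_Field[OF infk] k(1) by blast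
  \<comment> \<open>Forbidden for the new point of \<open>fst p\<close>: all earlier points, and all
    other members that the earlier points trace. The latter meet \<open>fst p\<close> in finite
    sets, and there are fewer than \<open>k\<close> of them.\<close>
  define avoid where "avoid g p = g ` underS r p \<union>
      (\<Union>A\<in>traces \<A> (g ` underS r p) - {fst p}. fst p \<inter> A)" for g :: "'a set \<times> nat set set \<Rightarrow> 'a" and p
  have "\<exists>x. \<forall>p. p \<in> P \<longrightarrow> x p \<in> fst p - avoid x p"
  proof (rule dependent_wf_choice[where R = "r - Id" and P = "\<lambda>g p y. p \<in> P \<longrightarrow> y \<in> fst p - avoid g p"])
    show "wf (r - Id)" using W well_order_on_def by blast
  next
    fix g h :: "'a set \<times> nat set set \<Rightarrow> 'a" and p y
    assume "\<And>z. (z, p) \<in> r - Id \<Longrightarrow> g z = h z"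
    then have "g ` underS r p = h ` underS r p" by (intro image_cong) (auto simp: underS_def)
    then show "(p \<in> P \<longrightarrow> y \<in> fst p - avoid g p) = (p \<in> P \<longrightarrow> y \<in> fst p - avoid h p)"
      by (simp add: avoid_def)
  next
    fix p and g :: "'a set \<times> nat set set \<Rightarrow> 'a"
    show "\<exists>y. p \<in> P \<longrightarrow> y \<in> fst p - avoid g p"
    proof (cases "p \<in> P")
      case True
      then have p: "fst p \<in> \<A>" by (auto simp: P_def)
      let ?S = "g ` underS r p"
      have "|underS r p| <o |P|" unfolding r_def using True by (rule card_of_underS_card_of)
      then have "|underS r p| <o k" using Pk by (rule ordLess_ordLeq_trans)
      with card_of_image have Sk: "|?S| <o k" by (rule ordLeq_ordLess_trans)
      \<comment> \<open>The choice principle quantifies over arbitrary \<open>g\<close>, whose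
        values may leave \<open>X\<close>; sparseness is therefore applied to
        \<open>?S \<inter> X\<close>.\<close>
      have "A \<inter> ?S = A \<inter> (?S \<inter> X)" if "A \<in> \<A>" for A using sub[OF that] by blast
      then have "traces \<A> ?S = traces \<A> (?S \<inter> X)" by auto
      then have "|traces \<A> ?S| \<le>o |?S \<inter> X|" using tr[of "?S \<inter> X"] by simp
      moreover have "|?S \<inter> X| <o k" by (rule card_of_subset_ordLess[OF _ Sk]) blast
      ultimately have "|traces \<A> ?S| <o k" by (rule ordLeq_ordLess_trans)
      then have "|traces \<A> ?S - {fst p}| <o k" by (rule card_of_subset_ordLess[rotated]) blast
      then have "|\<Union>A\<in>traces \<A> ?S - {fst p}. fst p \<inter> A| <o k"
        by (rule finite_Union_ordLess[OF k(1) infk]) (use p ad in auto)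
      with Sk have "|avoid g p| <o k"
        unfolding avoid_def by (rule card_of_Un_ordLess_infinite_Field[OF infk k(1)])
      then have "|avoid g p| <o |fst p|"
        using card[OF p] ordIso_symmetric ordLess_ordIso_trans by blast
      then have "\<not> fst p \<subseteq> avoid g p"
        using card_of_mono1 not_ordLess_ordLeq by blast
      then show ?thesis by blast
    qed blast
  qed
  then obtain x where x: "\<And>p. p \<in> P \<Longrightarrow> x p \<in> fst p - avoid x p" by blast
  have x_new: "x p \<notin> x ` underS r p" if "p \<in> P" for p
    using x[OF that] by (simp add: avoid_def)
  have x_avoid: "|A \<inter> x ` underS r p| \<le>o natLeq" if "p \<in> P" "A \<in> \<A>" "fst p \<noteq> A" "x p \<in> A" for p A
    using x[OF that(1)] that by (auto simp: avoid_def)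
  have inj: "inj_on x P"
  proof (rule inj_onI, rule ccontr)
    fix p q assume pq: "p \<in> P" "q \<in> P" "x p = x q" "p \<noteq> q"
    then have "p \<in> underS r q \<or> q \<in> underS r p"
      using underS_if_not_le[OF W, of p q] F by (auto simp: underS_def)
    then show False using imageI[of _ _ x] x_new pq(1-3) by metis
  qed
  \<comment> \<open>A default colour for points never chosen; it is given up in every
    member.\<close>
  obtain z where z: "z \<in> Field omega2" using infinite_omega2 infinite_imp_nonempty by blast
  define f where "f y = (if y \<in> x ` P then snd (inv_into P x y) else z)" for y
  have fx: "f (x p) = snd p" if "p \<in> P" for p
    using that inj by (simp add: f_def)
  have "f ` X \<subseteq> Field omega2"
  proof
    fix c assume "c \<in> f ` X"
    then obtain y where y: "c = f y" by blast
    show "c \<in> Field omega2"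
    proof (cases "y \<in> x ` P")
      case True
      then show ?thesis using y fx by (auto simp: P_def)
    qed (use y z in \<open>simp add: f_def\<close>)
  qed
  moreover have "well_colored f A" if A: "A \<in> \<A>" for A
  proof -
    \<comment> \<open>The pairs whose point falls into \<open>A\<close> although it was chosen for
      another member. By the choice of \<open>avoid\<close>, the points before such a pair do not
      trace \<open>A\<close>; so \<open>Q\<close> has countable initial segments, and at most
      \<open>omega1\<close> colours are lost.\<close>
    define Q where "Q = {p \<in> P. fst p \<noteq> A \<and> x p \<in> A}"
    have "|Q \<inter> underS r p| <o omega1" if p: "p \<in> Q" for p
    proof -
      have "x ` (Q \<inter> underS r p) \<subseteq> A \<inter> x ` underS r p" by (auto simp: Q_def)
      moreover have "inj_on x (Q \<inter> underS r p)"
        using inj by (rule inj_on_subset) (auto simp: Q_def)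
      ultimately have "|Q \<inter> underS r p| \<le>o |A \<inter> x ` underS r p|"
        unfolding card_of_ordLeq[symmetric] by blast
      moreover have "|A \<inter> x ` underS r p| \<le>o natLeq" using p A x_avoid by (auto simp: Q_def)
      ultimately show ?thesis unfolding ordLess_omega1 by (rule ordLeq_transitive)
    qed
    then have "|Q| \<le>o omega1"
      by (intro card_of_ordLeq_if_small_initial_segments[OF W Card_order_omega1])
        (auto simp: Q_def F)
    then have "|snd ` Q| \<le>o omega1" using card_of_image ordLeq_transitive by blast
    moreover have "|{z}| \<le>o omega1"
      using finite_imp_ordLess[OF Card_order_omega1 infinite_omega1, of "{z}"] ordLess_imp_ordLeq
      by blast
    ultimately have small: "|{z} \<union> snd ` Q| \<le>o omega1"
      using card_of_Un_ordLeq_infinite_Field[OF infinite_omega1 _ _ Card_order_omega1] by blast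
    have "Field omega2 - I_f f A \<subseteq> {z} \<union> snd ` Q"
    proof (rule subsetI, rule ccontr)
      fix \<xi> assume \<xi>: "\<xi> \<in> Field omega2 - I_f f A" "\<xi> \<notin> {z} \<union> snd ` Q"
      have p: "(A, \<xi>) \<in> P" using A \<xi> by (simp add: P_def)
      have xA: "x (A, \<xi>) \<in> A" using x[OF p] by simp
      have "A \<inter> f -` {\<xi>} = {x (A, \<xi>)}"
      proof (intro equalityI subsetI)
        fix y assume y: "y \<in> A \<inter> f -` {\<xi>}"
        then have "y \<in> x ` P" using \<xi>(2) by (auto simp: f_def split: if_splits)
        then obtain q where q: "q \<in> P" "y = x q" by blast
        then have sq: "snd q = \<xi>" using y fx by auto
        then have "q \<notin> Q" using \<xi>(2) by blast
        then have "fst q = A" using q y by (auto simp: Q_def)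
        then have "q = (A, \<xi>)" using sq by (simp add: prod_eq_iff)
        then show "y \<in> {x (A, \<xi>)}" using q by simp
      qed (use xA fx[OF p] in auto)
      then have "\<xi> \<in> I_f f A"
        using xA fx[OF p] unfolding I_f_def by force
      then show False using \<xi>(1) by blast
    qed
    then show ?thesis
      unfolding well_colored_def using small by (rule card_of_subset_ordLeq)
  qed
  ultimately show ?thesis by blast
qed

section \<open>Closing a set under the members it traces\<close>

definition hull :: "'a set set \<Rightarrow> 'a set \<Rightarrow> 'a set" where
  "hull \<A> S = (\<Union>n. ((\<lambda>T. T \<union> \<Union>(traces \<A> T)) ^^ n) S)"

lemma traces_mono: "S \<subseteq> T \<Longrightarrow> traces \<A> S \<subseteq> traces \<A> T"
  using card_of_subset_ordLeq[of "A \<inter> S" "A \<inter> T" natLeq for A] by blast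

lemma subset_hull: "S \<subseteq> hull \<A> S"
  unfolding hull_def by (rule order_trans[OF _ UN_upper[of 0]]) simp_all

lemma hull_mono:
  assumes "S \<subseteq> T"
  shows "hull \<A> S \<subseteq> hull \<A> T"
proof -
  let ?g = "\<lambda>T. T \<union> \<Union>(traces \<A> T)"
  have "(?g ^^ n) S \<subseteq> (?g ^^ n) T" for n
  proof (induction n)
    case (Suc n)
    then show ?case using traces_mono[OF Suc, of \<A>] by (simp only: funpow.simps comp_apply) blast
  qed (use assms in simp)
  then show ?thesis unfolding hull_def by blast
qed

lemma hull_subset:
  assumes "S \<subseteq> X" "\<And>A. A \<in> \<A> \<Longrightarrow> A \<subseteq> X"
  shows "hull \<A> S \<subseteq> X"
proof -
  let ?g = "\<lambda>T. T \<union> \<Union>(traces \<A> T)"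
  have "(?g ^^ n) S \<subseteq> X" for n
    by (induction n) (use assms in auto)
  then show ?thesis unfolding hull_def by blast
qed

text \<open>An uncountable set cut into countably many pieces has an uncountable piece. Hence
  \<open>A\<close> is already traced by some finite stage and is added at the next one, which is why
  \<omega> stages suffice.\<close>

lemma traces_hull_subset:
  assumes A: "A \<in> traces \<A> (hull \<A> S)"
  shows "A \<subseteq> hull \<A> S"
proof -
  let ?g = "\<lambda>T. T \<union> \<Union>(traces \<A> T)"
  have eq: "A \<inter> hull \<A> S = (\<Union>n. A \<inter> (?g ^^ n) S)" unfolding hull_def by blast
  have "\<exists>n. \<not> |A \<inter> (?g ^^ n) S| \<le>o natLeq"
  proof (rule ccontr)
    assume "\<nexists>n. \<not> |A \<inter> (?g ^^ n) S| \<le>o natLeq"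
    moreover have "|UNIV :: nat set| \<le>o natLeq"
      using card_of_nat by (rule ordIso_imp_ordLeq)
    ultimately have "|\<Union>n. A \<inter> (?g ^^ n) S| \<le>o natLeq"
      by (intro card_of_UNION_ordLeq_infinite_Field natLeq_Card_order) (auto simp: Field_natLeq)
    then show False using A eq by simp
  qed
  then obtain n where "A \<in> traces \<A> ((?g ^^ n) S)" using A by blast
  then have "A \<subseteq> (?g ^^ Suc n) S" by (simp only: funpow.simps comp_apply) blast
  then show ?thesis unfolding hull_def by blast
qed

text \<open>By sparseness each stage adds at most \<open>c\<close> members, each of size
  \<open>k \<le>o c\<close>.\<close>

lemma card_of_hull:
  assumes c: "Card_order c" "infinite (Field c)" and k: "k \<le>o c" and S: "|S| \<le>o c" "S \<subseteq> X"
    and sp: "sparse_system k \<A> X"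
  shows "|hull \<A> S| \<le>o c"
proof -
  let ?g = "\<lambda>T. T \<union> \<Union>(traces \<A> T)"
  have "|(?g ^^ n) S| \<le>o c \<and> (?g ^^ n) S \<subseteq> X" for n
  proof (induction n)
    case (Suc n)
    let ?T = "(?g ^^ n) S"
    have "|traces \<A> ?T| \<le>o |?T|" using Suc sp unfolding sparse_system_def by blast
    then have "|traces \<A> ?T| \<le>o c" using Suc ordLeq_transitive by blast
    moreover have "\<forall>A\<in>traces \<A> ?T. |A| \<le>o c"
    proof
      fix A assume "A \<in> traces \<A> ?T"
      then have "|A| =o k" using sp unfolding sparse_system_def by blast
      then show "|A| \<le>o c" using k by (rule ordIso_ordLeq_trans)
    qed
    ultimately have "|\<Union>A\<in>traces \<A> ?T. A| \<le>o c"
      by (rule card_of_UNION_ordLeq_infinite_Field[OF c(2,1)])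
    then have "|?T \<union> (\<Union>A\<in>traces \<A> ?T. A)| \<le>o c"
      using Suc card_of_Un_ordLeq_infinite_Field[OF c(2) _ _ c(1)] by blast
    moreover have "?T \<union> (\<Union>A\<in>traces \<A> ?T. A) \<subseteq> X"
      using Suc sp unfolding sparse_system_def by auto
    ultimately show ?case by (simp only: funpow.simps comp_apply image_ident) 
  qed (use S in simp)
  moreover have "|UNIV :: nat set| \<le>o c"
    using c infinite_iff_natLeq_ordLeq card_of_nat card_of_Field_ordIso
    by (metis ordIso_ordLeq_trans ordLeq_ordIso_trans)
  ultimately show ?thesis
    unfolding hull_def by (intro card_of_UNION_ordLeq_infinite_Field[OF c(2,1)]) auto
qed

section \<open>Arbitrary ground sets, by induction on their size\<close>

lemma ex_coloring:
  fixes X :: "'a set"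
  assumes k: "Card_order k" "omega2 \<le>o k"
  shows "sparse_system k \<A> X \<Longrightarrow> \<exists>f. f ` X \<subseteq> Field omega2 \<and> (\<forall>A\<in>\<A>. well_colored f A)"
\<comment> \<open>The system must vary, since the smaller ground sets carry truncated
  members.\<close>
proof (induction X arbitrary: \<A> rule: wf_induct_rule[OF wf_inv_image[OF wf_ordLess, of card_of]])
  case (1 X)
  note sp = 1(2)
  show ?case
  proof (cases "|X| \<le>o k")
    case True
    then show ?thesis by (rule ex_coloring_of_small_ground_set[OF k sp])
  next
    case False
    then have kX: "k <o |X|" using not_card_of_ordLeq[OF k(1)] by blast
    have infk: "infinite (Field k)"
      using infinite_Card_order_mono[OF Card_order_omega2 k(1) infinite_omega2 k(2)] .
    have infX: "infinite X"
      using infinite_Card_order_mono[OF k(1) card_of_Card_order infk ordLess_imp_ordLeq[OF kX]]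
      by (simp add: Field_card_of)
    have sub: "\<And>A. A \<in> \<A> \<Longrightarrow> A \<subseteq> X" and card: "\<And>A. A \<in> \<A> \<Longrightarrow> |A| =o k"
      and ad: "\<And>A A'. A \<in> \<A> \<Longrightarrow> A' \<in> \<A> \<Longrightarrow> A \<noteq> A' \<Longrightarrow> finite (A \<inter> A')"
      and tr: "\<And>S. S \<subseteq> X \<Longrightarrow> |traces \<A> S| \<le>o |S|"
      using sp unfolding sparse_system_def by auto
    have big: "omega1 <o |A|" if "A \<in> \<A>" for A
      using omega1_less[OF k(2) card[OF that]] .
    define r where "r = |X|"
    have W: "Well_order r" and F: "Field r = X"
      unfolding r_def by (rule card_of_Well_order, rule Field_card_of)
    have trans: "trans r" and antisym: "antisym r" using W unfolding order_on_defs by auto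
    \<comment> \<open>The increasing chain of closed sets; \<open>V i\<close> is what precedes stage
      \<open>i\<close>, and the differences \<open>D i\<close> defined below partition
      \<open>X\<close>.\<close>
    define H where "H i = hull \<A> (underS r i)" for i
    define V where "V i = (\<Union>j\<in>underS r i. H j)" for i
    have uX: "underS r i \<subseteq> X" for i unfolding F[symmetric] by (rule Order_Relation.underS_Field)
    have HX: "H i \<subseteq> X" for i unfolding H_def using uX sub by (rule hull_subset)
    have H_mono: "H i \<subseteq> H j" if "(i, j) \<in> r" for i j
      unfolding H_def using underS_incr[OF trans antisym that] by (rule hull_mono)
    have H_closed: "A \<subseteq> H i" if "A \<in> \<A>" "\<not> |A \<inter> H i| \<le>o natLeq" for A i
      using that traces_hull_subset[of A \<A> "underS r i"] unfolding H_def by blast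
    have H_small: "|H i| <o |X|" if i: "i \<in> X" for i
    proof -
      have u: "|underS r i| <o |X|" unfolding r_def using i by (rule card_of_underS_card_of)
      show ?thesis
      \<comment> \<open>The bound on hulls needs a cardinal of size at least \<open>k\<close>: it is
        \<open>k\<close> itself for short segments and the size of the segment for long ones. Both
        are below \<open>|X|\<close>.\<close>
      proof (cases "|underS r i| \<le>o k")
        case True
        have "|H i| \<le>o k" unfolding H_def
          using card_of_hull[OF k(1) infk ordLeq_reflexive True uX sp] k(1) card_order_on_def
          by blast
        then show ?thesis using kX by (rule ordLeq_ordLess_trans)
      next
        case False
        then have ku: "k \<le>o |underS r i|"
          using not_card_of_ordLeq[OF k(1)] ordLess_imp_ordLeq by blast
        have "|H i| \<le>o |underS r i|" unfolding H_def
          using card_of_hull[OF card_of_Card_order _ ku card_of_mono1[OF subset_refl] uX sp]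
            infinite_Card_order_mono[OF k(1) card_of_Card_order infk ku] by blast
        then show ?thesis using u by (rule ordLeq_ordLess_trans)
      qed
    qed
    define D where "D i = H i - V i" for i
    have "\<exists>i\<in>X. x \<in> D i" if x: "x \<in> X" for x
    proof -
      \<comment> \<open>An infinite cardinal has no largest element, so \<open>x\<close> lies in
        some proper initial segment.\<close>
      obtain i where i: "i \<in> Field r" "x \<noteq> i" "(x, i) \<in> r"
        using infinite_Card_order_limit[OF card_of_Card_order, of X x] x infX
        by (auto simp: Field_card_of r_def)
      then have "x \<in> H i" using subset_hull[of "underS r i" \<A>] by (auto simp: H_def underS_def)
      then show ?thesis
        using Well_order_least[OF W i(1), where P = "\<lambda>i. x \<in> H i"] by (auto simp: D_def V_def F)
    qed
    then obtain \<rho> where \<rho>: "\<And>x. x \<in> X \<Longrightarrow> \<rho> x \<in> X \<and> x \<in> D (\<rho> x)" by metis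
    have D_unique: "i = j" if "x \<in> D i" "x \<in> D j" "i \<in> X" "j \<in> X" for x i j
    proof (rule ccontr)
      assume "i \<noteq> j"
      then have "i \<in> underS r j \<or> j \<in> underS r i"
        using underS_if_not_le[OF W, of i j] that F by (auto simp: underS_def)
      then show False using that by (auto simp: D_def V_def)
    qed
    \<comment> \<open>The members traced for the first time at stage \<open>i\<close>.\<close>
    define \<B> where "\<B> i = {A \<in> \<A>. \<not> |A \<inter> H i| \<le>o natLeq \<and> (\<forall>j\<in>underS r i. |A \<inter> H j| \<le>o natLeq)}"
      for i
    have rank: "\<exists>i\<in>X. A \<in> \<B> i" if A: "A \<in> \<A>" for A
    proof -
      \<comment> \<open>If no stage indexed by a point of \<open>A\<close> traced \<open>A\<close>,
        all initial segments of \<open>A\<close> would be countable and \<open>A\<close> would have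
        size at most \<open>omega1\<close>.\<close>
      have "\<exists>i\<in>A. \<not> |A \<inter> H i| \<le>o natLeq"
      proof (rule ccontr)
        assume *: "\<not> (\<exists>i\<in>A. \<not> |A \<inter> H i| \<le>o natLeq)"
        have "|A \<inter> underS r i| <o omega1" if "i \<in> A" for i
        proof -
          have "|A \<inter> H i| \<le>o natLeq" using * that by blast
          then show ?thesis unfolding ordLess_omega1
            using subset_hull[of "underS r i" \<A>]
            by (intro card_of_subset_ordLeq[of "A \<inter> underS r i" "A \<inter> H i"]) (auto simp: H_def)
        qed
        then have "|A| \<le>o omega1"
          using sub[OF A] F
          by (intro card_of_ordLeq_if_small_initial_segments[OF W Card_order_omega1]) auto
        then show False using big[OF A] not_ordLess_ordLeq by blast
      qed
      then obtain i where "i \<in> Field r" "\<not> |A \<inter> H i| \<le>o natLeq" using sub[OF A] F by blast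
      then show ?thesis
        using Well_order_least[OF W, of i "\<lambda>i. \<not> |A \<inter> H i| \<le>o natLeq"] A
        by (auto simp: \<B>_def F)
    qed
    \<comment> \<open>Before stage \<open>i\<close> the traces of \<open>A\<close> form an
      increasing chain of countable sets, so \<open>chain_union_card\<close> applies whatever the
      cofinality of \<open>i\<close>.\<close>
    have AV: "|A \<inter> V i| \<le>o omega1" if "A \<in> \<B> i" for A i
    proof -
      have "A \<inter> V i = (\<Union>j\<in>underS r i. A \<inter> H j)" by (auto simp: V_def)
      moreover have "|\<Union>j\<in>underS r i. A \<inter> H j| \<le>o omega1"
        by (rule chain_union_card[OF W Order_Relation.underS_Field])
          (use H_mono that in \<open>auto simp: \<B>_def\<close>)
      ultimately show ?thesis by simp
    qed
    have AD: "A - V i \<subseteq> D i" if "A \<in> \<B> i" for A i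
      using H_closed[of A i] that by (auto simp: \<B>_def D_def)
    have sp_D: "sparse_system k ((\<lambda>A. A - V i) ` \<B> i) (D i)" for i
      unfolding sparse_system_def
    proof (intro conjI)
      \<comment> \<open>Removing at most \<open>omega1\<close> points does not change the size of
        \<open>A\<close>, which exceeds \<open>omega1\<close>.\<close>
      have "|A - V i| =o k" if A: "A \<in> \<B> i" for A
      proof -
        have A': "|A| =o k" "omega1 <o |A|" using A card big by (auto simp: \<B>_def)
        have le: "|A - V i| \<le>o k"
          using ordIso_imp_ordLeq[OF A'(1)] by (rule card_of_subset_ordLeq[rotated]) blast
        have infA: "infinite (Field |A| )"
          using infinite_Card_order_mono[OF Card_order_omega1 card_of_Card_order infinite_omega1]
            ordLess_imp_ordLeq[OF A'(2)] by blast
        have "\<not> |A - V i| <o |A|"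
        proof
          assume "|A - V i| <o |A|"
          moreover have "|A \<inter> V i| <o |A|" using AV[OF A] A'(2) by (rule ordLeq_ordLess_trans)
          ultimately have "|(A - V i) \<union> (A \<inter> V i)| <o |A|"
            by (rule card_of_Un_ordLess_infinite_Field[OF infA card_of_Card_order])
          moreover have "(A - V i) \<union> (A \<inter> V i) = A" by blast
          ultimately show False using ordLess_irreflexive by metis
        qed
        then have "|A| \<le>o |A - V i|" using not_card_of_ordLess[OF card_of_Card_order] by blast
        then have "k \<le>o |A - V i|" using A'(1) ordIso_symmetric ordIso_ordLeq_trans by blast
        with le show ?thesis unfolding ordIso_iff_ordLeq by blast
      qed
      then show "\<forall>A\<in>(\<lambda>A. A - V i) ` \<B> i. A \<subseteq> D i \<and> |A| =o k" using AD by blast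
    next
      show "\<forall>A\<in>(\<lambda>A. A - V i) ` \<B> i. \<forall>A'\<in>(\<lambda>A. A - V i) ` \<B> i. A \<noteq> A' \<longrightarrow> finite (A \<inter> A')"
      proof (intro ballI impI)
        fix C C' assume C: "C \<in> (\<lambda>A. A - V i) ` \<B> i" "C' \<in> (\<lambda>A. A - V i) ` \<B> i" "C \<noteq> C'"
        then obtain A A' where A: "C = A - V i" "C' = A' - V i" "A \<in> \<A>" "A' \<in> \<A>" "A \<noteq> A'"
          by (auto simp: \<B>_def)
        show "finite (C \<inter> C')"
          unfolding A(1,2) by (rule finite_subset[OF _ ad[OF A(3-5)]]) blast
      qed
    next
      show "\<forall>S\<subseteq>D i. |traces ((\<lambda>A. A - V i) ` \<B> i) S| \<le>o |S|"
      proof (intro allI impI)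
        fix S assume "S \<subseteq> D i"
        then have "S \<subseteq> X" using HX by (auto simp: D_def)
        \<comment> \<open>A truncated member is traced only if the full one is, so the count is
          inherited.\<close>
        have "\<not> |A \<inter> S| \<le>o natLeq" if "\<not> |(A - V i) \<inter> S| \<le>o natLeq" for A
          using that card_of_subset_ordLeq[of "(A - V i) \<inter> S" "A \<inter> S" natLeq] by blast
        then have "traces ((\<lambda>A. A - V i) ` \<B> i) S \<subseteq> (\<lambda>A. A - V i) ` traces \<A> S"
          by (auto simp: \<B>_def)
        moreover have "|(\<lambda>A. A - V i) ` traces \<A> S| \<le>o |S|"
          using card_of_image tr[OF \<open>S \<subseteq> X\<close>] by (rule ordLeq_transitive)
        ultimately show "|traces ((\<lambda>A. A - V i) ` \<B> i) S| \<le>o |S|"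
          by (rule card_of_subset_ordLeq)
      qed
    qed
    have D_small: "|D i| <o |X|" if "i \<in> X" for i
      using H_small[OF that] by (rule card_of_subset_ordLess[rotated]) (auto simp: D_def)
    have "\<exists>f. f ` D i \<subseteq> Field omega2 \<and> (\<forall>A\<in>(\<lambda>A. A - V i) ` \<B> i. well_colored f A)"
      if "i \<in> X" for i
      by (rule 1(1)[OF _ sp_D]) (use D_small[OF that] in simp)
    then obtain f where f: "\<And>i. i \<in> X \<Longrightarrow> f i ` D i \<subseteq> Field omega2"
        "\<And>i A. i \<in> X \<Longrightarrow> A \<in> \<B> i \<Longrightarrow> well_colored (f i) (A - V i)"
      by (metis imageI)
    \<comment> \<open>Each point is coloured by the colouring of the unique difference set
      containing it.\<close>
    define g where "g x = f (\<rho> x) x" for x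
    have "g x \<in> Field omega2" if "x \<in> X" for x
      using f(1)[of "\<rho> x"] \<rho>[OF that] unfolding g_def by blast
    then have "g ` X \<subseteq> Field omega2" by blast
    moreover have "well_colored g A" if A: "A \<in> \<A>" for A
    proof -
      obtain i where i: "i \<in> X" "A \<in> \<B> i" using rank[OF A] by blast
      have "A - (A - V i) = A \<inter> V i" by blast
      then have "|A - (A - V i)| \<le>o omega1" using AV[OF i(2)] by simp
      \<comment> \<open>On \<open>A - V i\<close>, which lies in \<open>D i\<close>, the glued
        colouring agrees with \<open>f i\<close>; the remaining at most \<open>omega1\<close> points
        are absorbed by \<open>well_colored_extend\<close>.\<close>
      moreover have "g x = f i x" if x: "x \<in> A - V i" for x
      proof -
        have "\<rho> x = i" using D_unique[of x "\<rho> x" i] \<rho>[of x] AD[OF i(2)] i x sub[OF A] by blast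
        then show ?thesis by (simp add: g_def)
      qed
      ultimately show ?thesis
        using f(2)[OF i] by (intro well_colored_extend[of "A - V i" A "f i"]) auto
    qed
    ultimately show ?thesis by blast
  qed
qed

section \<open>From the given system to a sparse one\<close>

theorem theorem8p6:
  fixes l :: "'l rel" and k :: "'k rel" and \<A> :: "'a set set"
  assumes "Card_order l"
    and "omega2 \<le>o l"
    and "\<forall>M :: 'l set. card_of M <o l \<and> cf_is_omega (card_of M) \<longrightarrow>
           BNF_Cardinal_Arithmetic.cexp (card_of M) natLeq =o cardSuc (card_of M)"
    and "Card_order k"
    and "omega2 \<le>o k"
    and "k \<le>o l"
    and "is_system \<A> l k natLeq"
  shows "\<exists>f :: 'a \<Rightarrow> nat set set. f ` (\<Union>\<A>) \<subseteq> Field omega2 \<and>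
           (\<forall>A\<in>\<A>. card_of (Field omega2 - I_f f A) <o omega2)"
proof -
  have infl: "infinite (Field l)"
    using infinite_Card_order_mono[OF Card_order_omega2 assms(1) infinite_omega2 assms(2)] .
  have card: "|\<A>| =o l" "\<And>A. A \<in> \<A> \<Longrightarrow> |A| =o k"
    and ad: "\<And>A A'. A \<in> \<A> \<Longrightarrow> A' \<in> \<A> \<Longrightarrow> A \<noteq> A' \<Longrightarrow> finite (A \<inter> A')"
    using assms(7) by (auto simp: is_system_def finite_iff_ordLess_natLeq)
  have "|A| \<le>o l" if "A \<in> \<A>" for A
    using card(2)[OF that] assms(6) by (rule ordIso_ordLeq_trans)
  then have "|\<Union>A\<in>\<A>. A| \<le>o l"
    by (intro card_of_UNION_ordLeq_infinite_Field[OF infl assms(1)] ordIso_imp_ordLeq[OF card(1)] ballI)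
  then have X: "|\<Union>\<A>| \<le>o l" by simp
  \<comment> \<open>The ground set has size at most \<open>l\<close>, so the arithmetical hypothesis
    controls the traces on each of its subsets.\<close>
  have "|traces \<A> S| \<le>o |S|" if "S \<subseteq> \<Union>\<A>" for S
  proof (rule card_uncountable_trace[OF assms(1)])
    show "|S| \<le>o l" using that X by (rule card_of_subset_ordLeq)
  qed (use assms(3) ad in auto)
  then have "sparse_system k \<A> (\<Union>\<A>)"
    using card(2) ad by (auto simp: sparse_system_def)
  then show ?thesis
    using ex_coloring[OF assms(4,5)] unfolding well_colored_def ordLess_omega2 by blast
qed

end
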